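(* Let $m=2k$ be a positive even integer and $n$ a positive integer. Then $$SOS_{m,n}^*=\Big\{(b_{\boldsymbol{\alpha}})_{|\boldsymbol{\alpha}|=m}\in S_{m,n}:\ \sum_{|\boldsymbol{\alpha}|=m}b_{\boldsymbol{\alpha}}A_{\boldsymbol{\alpha}}\succeq 0\Big\}.$$
   Context: $S_{m,n}$ is the space of real symmetric tensors $\mathcal{A}=(a_{i_1\cdots i_m})$ of order $m$ and dimension $n$ (symmetric: entries invariant under permutation of indices), with inner product $\langle\mathcal{A},\mathcal{B}\rangle=\sum_{i_1,\dots,i_m}a_{i_1\cdots i_m}b_{i_1\cdots i_m}$. For $\mathbf{x}\in\mathbb{R}^n$, $\mathcal{A}\mathbf{x}^m=\sum_{i_1,\dots,i_m}a_{i_1\cdots i_m}x_{i_1}\cdots x_{i_m}$. The independent entries of $\mathcal{A}\in S_{m,n}$ are indexed by exponent tuples $\boldsymbol{\alpha}=(\alpha_0,\dots,\alpha_{n-1})$ of nonnegative integers with $|\boldsymbol{\alpha}|=\sum_i\alpha_i=m$: $a_{\boldsymbol{\alpha}}$ is the common value of the entries whose index tuple contains the $j$th index value exactly $\alpha_j$ times ($j=0,\dots,n-1$), and one writes $\mathcal{A}=(a_{\boldsymbol{\alpha}})_{|\boldsymbol{\alpha}|=m}$. A tensor $\mathcal{A}\in S_{m,n}$ is an SOS tensor if $\mathcal{A}\mathbf{x}^m$ is a sum of squares of real polynomials in $\mathbf{x}\in\mathbb{R}^n$; $SOS_{m,n}$ is the set of all SOS tensors in $S_{m,n}$. The dual cone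 is $SOS_{m,n}^*=\{\mathcal{B}\in S_{m,n}:\langle\mathcal{B},\mathcal{A}\rangle\ge 0\text{ for all }\mathcal{A}\in SOS_{m,n}\}$. For each $|\boldsymbol{\alpha}|=m$, $A_{\boldsymbol{\alpha}}$ is the real symmetric $\binom{n+k-1}{k}\times\binom{n+k-1}{k}$ matrix with rows and columns indexed by the exponent tuples $\boldsymbol{\beta},\boldsymbol{\gamma}\in\mathbb{Z}_{\ge0}^n$ with $|\boldsymbol{\beta}|=|\boldsymbol{\gamma}|=k$, whose $(\boldsymbol{\beta},\boldsymbol{\gamma})$ entry is $1$ if $\boldsymbol{\beta}+\boldsymbol{\gamma}=\boldsymbol{\alpha}$ and $0$ otherwise. $M\succeq 0$ means $M$ is positive semidefinite. *)

theory Defs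
  imports "HOL-Analysis.Analysis" "HOL-Combinatorics.Permutations"
begin

text \<open>
  A tensor of order \<open>m = CARD('m)\<close> and dimension \<open>n = CARD('n)\<close> is a vector indexed by the
  index tuples \<open>i :: 'm \<Rightarrow> 'n\<close>; the entry at \<open>i\<close> is \<open>A $ i\<close>. Its inner product is then that of the
  library, see \<open>inner_tensor\<close> below.
\<close>

type_synonym ('m, 'n) tensor = "real ^ ('m \<Rightarrow> 'n)"

lemma inner_tensor:
  fixes A B :: "('m::finite, 'n::finite) tensor"
  shows "A \<bullet> B = (\<Sum>i\<in>UNIV. A $ i * B $ i)"
  by (simp add: inner_vec_def)

definition sym_tensors :: "('m::finite, 'n::finite) tensor set" where
  "sym_tensors = {A. \<forall>p i. p permutes UNIV \<longrightarrow> A $ (i \<circ> p) = A $ i}"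

definition tensor_form :: "('m::finite, 'n::finite) tensor \<Rightarrow> real ^ 'n \<Rightarrow> real" where
  "tensor_form A x = (\<Sum>i\<in>UNIV. A $ i * (\<Prod>l\<in>UNIV. x $ i l))"

text \<open>
  Real polynomials in \<open>x \<in> \<real>\<^sup>n\<close> are taken as polynomial functions, which over the infinite field of
  real numbers is the same as formal polynomials.
\<close>

definition sum_of_squares :: "(real ^ 'n::finite \<Rightarrow> real) \<Rightarrow> bool" where
  "sum_of_squares f \<longleftrightarrow> (\<exists>(r::nat) q. (\<forall>s<r. real_polynomial_function (q s)) \<and>
     (\<forall>x. f x = (\<Sum>s<r. (q s x)\<^sup>2)))"

definition SOS_tensors :: "('m::finite, 'n::finite) tensor set" where
  "SOS_tensors = {A \<in> sym_tensors. sum_of_squares (tensor_form A)}"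

definition SOS_dual :: "('m::finite, 'n::finite) tensor set" where
  "SOS_dual = {B \<in> sym_tensors. \<forall>A\<in>SOS_tensors. B \<bullet> A \<ge> 0}"

definition exponents :: "nat \<Rightarrow> ('n::finite \<Rightarrow> nat) set" where
  "exponents d = {\<alpha>. (\<Sum>j\<in>UNIV. \<alpha> j) = d}"

lemma finite_exponents: "finite (exponents d :: ('n::finite \<Rightarrow> nat) set)"
proof (rule finite_subset)
  show "(exponents d :: ('n \<Rightarrow> nat) set) \<subseteq> (\<Pi>\<^sub>E j\<in>UNIV. {..d})"
    by (auto simp: exponents_def intro!: member_le_sum)
  show "finite (\<Pi>\<^sub>E j\<in>(UNIV :: 'n set). {..d})"
    by (intro finite_PiE) auto
qed

definition content :: "('m::finite \<Rightarrow> 'n) \<Rightarrow> 'n \<Rightarrow> nat" where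
  "content i j = card {l. i l = j}"

lemma content_in_exponents:
  "content (i :: 'm::finite \<Rightarrow> 'n::finite) \<in> exponents CARD('m)"
proof -
  have "(\<Sum>j\<in>UNIV. card {l\<in>UNIV. i l = j}) = card (UNIV :: 'm set)"
    by (subst card_eq_sum, subst sum.group[of UNIV UNIV i "\<lambda>_. 1", symmetric]) auto
  then show ?thesis
    by (simp add: exponents_def content_def)
qed

text \<open>
  \<open>entry A \<alpha>\<close> is the common value of the entries of \<open>A\<close> whose index tuple has content \<open>\<alpha>\<close>; it is
  meaningful only for symmetric \<open>A\<close> and \<open>\<alpha> \<in> exponents CARD('m)\<close>.
\<close>

definition entry :: "('m::finite, 'n::finite) tensor \<Rightarrow> ('n \<Rightarrow> nat) \<Rightarrow> real" where
  "entry A \<alpha> = (THE a. \<forall>i. content i = \<alpha> \<longrightarrow> A $ i = a)"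

lemma entry_content:
  fixes A :: "('m::finite, 'n::finite) tensor"
  assumes "A \<in> sym_tensors"
  shows "entry A (content i) = A $ i"
  unfolding entry_def
proof (rule the_equality)
  show "\<forall>i'. content i' = content i \<longrightarrow> A $ i' = A $ i"
  proof (intro allI impI)
    fix i' :: "'m \<Rightarrow> 'n"
    assume eq: "content i' = content i"
    have "image_mset i' (mset_set UNIV) = image_mset i (mset_set UNIV)"
    proof (rule multiset_eqI)
      fix j
      have "content i' j = content i j"
        using eq by simp
      then show "count (image_mset i' (mset_set UNIV)) j = count (image_mset i (mset_set UNIV)) j"
        by (simp add: content_def count_image_mset' Collect_conj_eq eq_commute)
    qed
    then obtain p where "p permutes UNIV" "\<forall>l\<in>UNIV. i' l = i (p l)"
      using image_mset_eq_implies_permutes[of UNIV i' i] by auto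
    moreover from this have "i' = i \<circ> p"
      by auto
    ultimately show "A $ i' = A $ i"
      using assms by (simp add: sym_tensors_def)
  qed
qed auto

text \<open>Matrices with rows and columns indexed by exponent tuples are functions of two such tuples.\<close>

definition exponent_matrix :: "('n \<Rightarrow> nat) \<Rightarrow> ('n \<Rightarrow> nat) \<Rightarrow> ('n \<Rightarrow> nat) \<Rightarrow> real" where
  "exponent_matrix \<alpha> \<beta> \<gamma> = (if (\<lambda>j. \<beta> j + \<gamma> j) = \<alpha> then 1 else 0)"

definition psd_on :: "'i set \<Rightarrow> ('i \<Rightarrow> 'i \<Rightarrow> real) \<Rightarrow> bool" where
  "psd_on I M \<longleftrightarrow> (\<forall>a\<in>I. \<forall>b\<in>I. M a b = M b a) \<and>
     (\<forall>v. (\<Sum>a\<in>I. \<Sum>b\<in>I. v a * M a b * v b) \<ge> 0)"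

end

theory Submission
  imports Defs
begin

text \<open>
  If a form of degree \<open>2 * k\<close> is a sum of squares of polynomials \<open>q s\<close>, then \<open>\<bar>q s (t *\<^sub>R x)\<bar>\<close> is
  bounded by a multiple of \<open>t ^ k\<close> for all \<open>t > 0\<close>, so each \<open>q s\<close> is itself a form of degree \<open>k\<close>.
  Pairing \<open>B\<close> with a tensor depends only on the coefficients of the associated form, and for the square
  of the form with coefficients \<open>v\<close> the pairing is the value at \<open>v\<close> of the quadratic form of the
  matrix in the theorem.
\<close>

section \<open>Univariate growth\<close>

text \<open>As \<open>t\<close> tends to infinity, the largest positive exponent with nonzero total
  coefficient would dominate and make the sum unbounded. Real exponents permit the negative shifted
  ones that occur in \<open>power_sum_bounded_imp_zero\<close>.\<close>

lemma powr_sum_bounded_imp_zero: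
  fixes a f :: "'s \<Rightarrow> real"
  assumes S: "finite S" and bd: "\<And>t. t > 0 \<Longrightarrow> \<bar>\<Sum>s\<in>S. a s * t powr f s\<bar> \<le> C" and "r > 0"
  shows "(\<Sum>s\<in>{s\<in>S. f s = r}. a s) = 0"
proof (rule ccontr)
  \<comment> \<open>Since \<open>f\<close> need not be injective, coefficients are first totalled
    per exponent.\<close>
  define A where "A r = (\<Sum>s\<in>{s\<in>S. f s = r}. a s)" for r
  define R where "R = {r\<in>f ` S. r > 0 \<and> A r \<noteq> 0}"
  assume "(\<Sum>s\<in>{s\<in>S. f s = r}. a s) \<noteq> 0"
  then have "A r \<noteq> 0"
    by (simp add: A_def)
  have outside: "A e = 0" if "e \<notin> f ` S" for e
  proof -
    have "{s\<in>S. f s = e} = {}"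
      using that by auto
    then show ?thesis
      unfolding A_def by (simp only: sum.empty)
  qed
  have "finite R" "r \<in> R"
    using S \<open>A r \<noteq> 0\<close> \<open>r > 0\<close> outside[of r] by (auto simp: R_def)
  define e0 where "e0 = Max R"
  have "e0 \<in> R"
    unfolding e0_def using \<open>finite R\<close> \<open>r \<in> R\<close> by (intro Max_in) auto
  then have e0: "e0 \<in> f ` S" "e0 > 0" "A e0 \<noteq> 0"
    by (auto simp: R_def)
  have above: "A e = 0" if "e > e0" for e
  proof (rule ccontr)
    assume "A e \<noteq> 0"
    then have "e \<in> R"
      using that e0 outside[of e] by (auto simp: R_def)
    then show False
      using Max_ge[OF \<open>finite R\<close>] that unfolding e0_def by fastforce
  qed
  have group: "(\<Sum>s\<in>S. a s * t powr f s) = (\<Sum>e\<in>f ` S. A e * t powr e)" for t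
    unfolding A_def sum_distrib_right
    by (subst sum.group[OF S finite_imageI[OF S] order_refl, symmetric])
      (auto intro!: sum.cong)
  \<comment> \<open>After division by \<open>t powr e0\<close>, terms with smaller exponents decay
    and those with larger exponents have total zero by maximality, so only \<open>A e0\<close>
    survives in the limit.\<close>
  have "((\<lambda>t. A e * t powr (e - e0)) \<longlongrightarrow> (if e = e0 then A e else 0)) at_top" for e
  proof (cases e e0 rule: linorder_cases)
    case less
    then have "((\<lambda>t::real. t powr (e - e0)) \<longlongrightarrow> 0) at_top"
      by (intro tendsto_neg_powr) (auto simp: filterlim_ident)
    with less show ?thesis
      by (auto intro: tendsto_mult_right_zero)
  next
    case equal
    have "eventually (\<lambda>t::real. A e * t powr (e - e0) = A e) at_top"
      using eventually_gt_at_top[of 0] by eventually_elim (simp add: equal)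
    then show ?thesis
      using equal by (simp add: tendsto_eventually)
  next
    case greater
    then show ?thesis
      by (simp add: above)
  qed
  then have "((\<lambda>t. \<Sum>e\<in>f ` S. A e * t powr (e - e0)) \<longlongrightarrow>
      (\<Sum>e\<in>f ` S. if e = e0 then A e else 0)) at_top"
    by (intro tendsto_sum)
  then have lim: "((\<lambda>t. \<Sum>e\<in>f ` S. A e * t powr (e - e0)) \<longlongrightarrow> A e0) at_top"
    using e0 S by simp
  \<comment> \<open>The same quotient also tends to 0, being a bounded sum divided by a positive
    power of \<open>t\<close>.\<close>
  have "((\<lambda>t. \<Sum>e\<in>f ` S. A e * t powr (e - e0)) \<longlongrightarrow> 0) at_top"
  proof (rule Lim_null_comparison)
    show "eventually (\<lambda>t. norm (\<Sum>e\<in>f ` S. A e * t powr (e - e0)) \<le> C * t powr (- e0)) at_top"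
      using eventually_gt_at_top[of 0]
    proof eventually_elim
      case (elim t)
      have "(\<Sum>e\<in>f ` S. A e * t powr (e - e0)) = (\<Sum>s\<in>S. a s * t powr f s) * t powr (- e0)"
        unfolding group sum_distrib_right
        by (intro sum.cong refl) (simp add: powr_add[symmetric])
      then show ?case
        using bd[OF elim] by (simp add: abs_mult mult_right_mono)
    qed
    have "((\<lambda>t::real. t powr (- e0)) \<longlongrightarrow> 0) at_top"
      using e0 by (intro tendsto_neg_powr) (auto simp: filterlim_ident)
    then show "((\<lambda>t. C * t powr (- e0)) \<longlongrightarrow> 0) at_top"
      by (rule tendsto_mult_right_zero)
  qed
  with lim have "A e0 = 0"
    using tendsto_unique trivial_limit_at_top_linorder by blast
  with e0 show False
    by simp
qed

text \<open>Division by \<open>t ^ k\<close> leaves a bounded sum with exponents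
  \<open>d s - k\<close>. Its behaviour at infinity excludes degrees above \<open>k\<close>, its
  behaviour near 0 those below.\<close>

lemma power_sum_bounded_imp_zero:
  fixes a :: "'s \<Rightarrow> real"
  assumes S: "finite S" and bd: "\<And>t. t > 0 \<Longrightarrow> \<bar>\<Sum>s\<in>S. a s * t ^ d s\<bar> \<le> C * t ^ k" and "e \<noteq> k"
  shows "(\<Sum>s\<in>{s\<in>S. d s = e}. a s) = 0"
proof -
  have bd': "\<bar>\<Sum>s\<in>S. a s * t powr (real (d s) - real k)\<bar> \<le> C" if "t > 0" for t
  proof -
    have "(\<Sum>s\<in>S. a s * t powr (real (d s) - real k)) = (\<Sum>s\<in>S. a s * t ^ d s) / t ^ k"
      unfolding sum_divide_distrib using that
      by (intro sum.cong refl) (simp add: powr_diff powr_realpow)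
    then show ?thesis
      using bd[OF that] that by (simp add: abs_divide pos_divide_le_eq)
  qed
  \<comment> \<open>Replacing \<open>t\<close> by \<open>1 / t\<close> reverses the sign of every
    exponent, so degrees below \<open>k\<close> turn into positive exponents.\<close>
  have bd_inv: "\<bar>\<Sum>s\<in>S. a s * t powr (real k - real (d s))\<bar> \<le> C" if "t > 0" for t
  proof -
    have "t powr (real k - real (d s)) = (1 / t) powr (real (d s) - real k)" for s
      using that by (simp add: powr_divide powr_diff field_simps)
    then show ?thesis
      using bd'[of "1 / t"] that by simp
  qed
  show ?thesis
  proof (cases "e > k")
    case True
    then show ?thesis
      using powr_sum_bounded_imp_zero[OF S bd', of "real e - real k"] by simp
  next
    case False
    then show ?thesis
      using powr_sum_bounded_imp_zero[OF S bd_inv, of "real k - real e"] \<open>e \<noteq> k\<close> by simp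
  qed
qed

section \<open>Monomials\<close>

definition monomial_fun :: "('n::finite \<Rightarrow> nat) \<Rightarrow> real ^ 'n \<Rightarrow> real" where
  "monomial_fun \<beta> x = (\<Prod>j\<in>UNIV. x $ j ^ \<beta> j)"

lemma monomial_fun_add: "monomial_fun (\<lambda>j. \<beta> j + \<gamma> j) x = monomial_fun \<beta> x * monomial_fun \<gamma> x"
  by (simp add: monomial_fun_def power_add prod.distrib)

lemma monomial_fun_zero: "monomial_fun (\<lambda>j. 0) x = 1"
  by (simp add: monomial_fun_def)

lemma monomial_fun_unit: "monomial_fun (\<lambda>i. if i = j then 1 else 0) x = x $ j"
proof -
  have "monomial_fun (\<lambda>i. if i = j then 1 else 0) x = (\<Prod>i\<in>UNIV. if i = j then x $ i else 1)"
    unfolding monomial_fun_def by (intro prod.cong) auto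
  then show ?thesis
    by simp
qed

lemma monomial_fun_scaleR: "monomial_fun \<beta> (t *\<^sub>R x) = t ^ (\<Sum>j\<in>UNIV. \<beta> j) * monomial_fun \<beta> x"
  by (simp add: monomial_fun_def power_mult_distrib prod.distrib power_sum)

lemma real_polynomial_function_monomial_fun: "real_polynomial_function (monomial_fun \<beta>)"
  unfolding monomial_fun_def[abs_def]
  by (intro real_polynomial_function_prod real_polynomial_function_power
      real_polynomial_function.intros(1) bounded_linear_vec_nth) auto

lemma prod_nth_eq_monomial_fun:
  fixes i :: "'m::finite \<Rightarrow> 'n::finite"
  shows "(\<Prod>l\<in>UNIV. x $ i l) = monomial_fun (content i) x"
proof -
  have "(\<Prod>l\<in>UNIV. x $ i l) = (\<Prod>j\<in>UNIV. \<Prod>l\<in>{l\<in>UNIV. i l = j}. x $ i l)"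
    by (subst prod.group) auto
  also have "\<dots> = (\<Prod>j\<in>UNIV. x $ j ^ content i j)"
    by (intro prod.cong refl) (simp add: content_def)
  finally show ?thesis
    by (simp add: monomial_fun_def)
qed

section \<open>Expansions in monomials and uniqueness of their coefficients\<close>

definition monomial_expansion :: "(real ^ 'n::finite \<Rightarrow> real) \<Rightarrow> bool" where
  "monomial_expansion q \<longleftrightarrow> (\<exists>S c. finite S \<and> (\<forall>x. q x = (\<Sum>\<beta>\<in>S. c \<beta> * monomial_fun \<beta> x)))"

text \<open>Terms sharing an exponent are collected. Sums and products of expansions can thus be
  indexed by disjoint unions and Cartesian products, whatever exponents coincide.\<close>

lemma monomial_expansionI:
  assumes I: "finite I" and q: "\<And>x. q x = (\<Sum>a\<in>I. c a * monomial_fun (e a) x)"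
  shows "monomial_expansion q"
  unfolding monomial_expansion_def
proof (intro exI conjI allI)
  show "finite (e ` I)"
    using I by simp
  show "q x = (\<Sum>\<beta>\<in>e ` I. (\<Sum>a\<in>{a\<in>I. e a = \<beta>}. c a) * monomial_fun \<beta> x)" for x
    unfolding q sum_distrib_right
    by (subst sum.group[OF I finite_imageI[OF I] order_refl, symmetric])
      (auto intro!: sum.cong)
qed

lemma real_polynomial_function_imp_expansion:
  fixes q :: "real ^ 'n::finite \<Rightarrow> real"
  assumes "real_polynomial_function q"
  shows "monomial_expansion q"
  using assms
proof induction
  case (linear f)
  \<comment> \<open>A linear functional is determined by its values on the standard basis, which
    become the coefficients of the coordinate functions.\<close>
  have "f x = (\<Sum>j\<in>UNIV. f (axis j 1) * monomial_fun (\<lambda>i. if i = j then 1 else 0) x)" for x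
  proof -
    interpret bounded_linear f by fact
    have "f x = f (\<Sum>j\<in>UNIV. x $ j *\<^sub>R axis j 1)"
      using basis_expansion[of x] by (simp add: scalar_mult_eq_scaleR)
    then show ?thesis
      unfolding monomial_fun_unit by (simp add: sum scale mult.commute)
  qed
  then show ?case
    by (rule monomial_expansionI[OF finite])
next
  case (const c)
  show ?case
    by (rule monomial_expansionI[of "{()}" _ "\<lambda>_. c" "\<lambda>_ _. 0"]) (simp_all add: monomial_fun_zero)
next
  case (add f g)
  obtain S c where S: "finite S" "\<And>x. f x = (\<Sum>\<beta>\<in>S. c \<beta> * monomial_fun \<beta> x)"
    using add.IH(1) unfolding monomial_expansion_def by blast
  obtain T d where T: "finite T" "\<And>x. g x = (\<Sum>\<beta>\<in>T. d \<beta> * monomial_fun \<beta> x)"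
    using add.IH(2) unfolding monomial_expansion_def by blast
  show ?case
  proof (rule monomial_expansionI)
    show "finite (S <+> T)"
      using S T by simp
    show "f x + g x = (\<Sum>a\<in>S <+> T. case_sum c d a *
        monomial_fun (case_sum (\<lambda>\<beta>. \<beta>) (\<lambda>\<beta>. \<beta>) a) x)" for x
      unfolding S T by (simp add: sum.Plus S(1) T(1))
  qed
next
  case (mult f g)
  obtain S c where S: "finite S" "\<And>x. f x = (\<Sum>\<beta>\<in>S. c \<beta> * monomial_fun \<beta> x)"
    using mult.IH(1) unfolding monomial_expansion_def by blast
  obtain T d where T: "finite T" "\<And>x. g x = (\<Sum>\<beta>\<in>T. d \<beta> * monomial_fun \<beta> x)"
    using mult.IH(2) unfolding monomial_expansion_def by blast
  show ?case
  proof (rule monomial_expansionI)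
    show "finite (S \<times> T)"
      using S T by simp
    show "f x * g x = (\<Sum>p\<in>S \<times> T. (c (fst p) * d (snd p)) *
        monomial_fun (\<lambda>j. fst p j + snd p j) x)" for x
      unfolding S T sum_product sum.cartesian_product
      by (intro sum.cong refl) (auto simp: monomial_fun_add)
  qed
qed

text \<open>Variables are separated one at a time, by viewing the sum as a polynomial in a single
  coordinate. The product over \<open>J\<close> cannot distinguish exponents that agree on
  \<open>J\<close>, hence a sum of coefficients; for \<open>J = UNIV\<close> it reduces to one
  coefficient.\<close>

lemma monomial_sum_zero_imp_partial:
  fixes c :: "('n::finite \<Rightarrow> nat) \<Rightarrow> real"
  assumes "finite J" "finite S" "\<And>x :: real ^ 'n. (\<Sum>\<beta>\<in>S. c \<beta> * (\<Prod>j\<in>J. x $ j ^ \<beta> j)) = 0"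
  shows "(\<Sum>\<beta>\<in>{\<beta>\<in>S. \<forall>j\<in>J. \<beta> j = \<beta>0 j}. c \<beta>) = 0"
  using assms
proof (induction J arbitrary: S rule: finite_induct)
  case empty
  then show ?case
    by simp
next
  case (insert i J)
  have "(\<Sum>\<beta>\<in>{\<beta>\<in>{\<beta>\<in>S. \<beta> i = \<beta>0 i}. \<forall>j\<in>J. \<beta> j = \<beta>0 j}. c \<beta>) = 0"
  proof (rule insert.IH)
    show "finite {\<beta>\<in>S. \<beta> i = \<beta>0 i}"
      using insert by simp
    fix x :: "real ^ 'n"
    have "(\<Sum>\<beta>\<in>S. (c \<beta> * (\<Prod>j\<in>J. x $ j ^ \<beta> j)) * t ^ \<beta> i) = 0" for t
    proof -
      \<comment> \<open>Coordinate \<open>i\<close> becomes the free parameter \<open>t\<close>; as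
        \<open>i\<close> lies outside \<open>J\<close>, the product over \<open>J\<close> is
        unaffected.\<close>
      define y :: "real ^ 'n" where "y = (\<chi> j. if j = i then t else x $ j)"
      have "(\<Prod>j\<in>J. y $ j ^ \<beta> j) = (\<Prod>j\<in>J. x $ j ^ \<beta> j)" for \<beta>
        using insert by (intro prod.cong) (auto simp: y_def)
      then show ?thesis
        using insert.prems(2)[of y] insert.hyps by (simp add: y_def mult_ac)
    qed
    \<comment> \<open>A vanishing sum meets the growth bound with constant 0 for every
      \<open>k\<close>; \<open>Suc (\<beta>0 i)\<close> serves as a degree different from
      \<open>\<beta>0 i\<close>.\<close>
    then show "(\<Sum>\<beta>\<in>{\<beta>\<in>S. \<beta> i = \<beta>0 i}. c \<beta> * (\<Prod>j\<in>J. x $ j ^ \<beta> j)) = 0"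
      using insert.prems by (intro power_sum_bounded_imp_zero[where C = 0 and k = "Suc (\<beta>0 i)"]) auto
  qed
  moreover have "{\<beta>\<in>{\<beta>\<in>S. \<beta> i = \<beta>0 i}. \<forall>j\<in>J. \<beta> j = \<beta>0 j} =
      {\<beta>\<in>S. \<forall>j\<in>insert i J. \<beta> j = \<beta>0 j}"
    by auto
  ultimately show ?case
    by simp
qed

lemma monomial_fun_coeffs_unique:
  fixes c d :: "('n::finite \<Rightarrow> nat) \<Rightarrow> real"
  assumes S: "finite S" and "\<alpha> \<in> S"
    and eq: "\<And>x. (\<Sum>\<beta>\<in>S. c \<beta> * monomial_fun \<beta> x) = (\<Sum>\<beta>\<in>S. d \<beta> * monomial_fun \<beta> x)"
  shows "c \<alpha> = d \<alpha>"
proof -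
  have "(\<Sum>\<beta>\<in>{\<beta>\<in>S. \<forall>j\<in>UNIV. \<beta> j = \<alpha> j}. c \<beta> - d \<beta>) = 0"
    using eq by (intro monomial_sum_zero_imp_partial S)
      (simp_all add: monomial_fun_def left_diff_distrib sum_subtractf)
  moreover have "{\<beta>\<in>S. \<forall>j\<in>UNIV. \<beta> j = \<alpha> j} = {\<alpha>}"
    using \<open>\<alpha> \<in> S\<close> by auto
  ultimately show ?thesis
    by simp
qed

section \<open>Forms and their squares\<close>

definition form :: "nat \<Rightarrow> (('n::finite \<Rightarrow> nat) \<Rightarrow> real) \<Rightarrow> real ^ 'n \<Rightarrow> real" where
  "form k v x = (\<Sum>\<beta>\<in>exponents k. v \<beta> * monomial_fun \<beta> x)"

lemma real_polynomial_function_form: "real_polynomial_function (form k v)"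
  unfolding form_def[abs_def]
  by (intro real_polynomial_function_sum finite_exponents real_polynomial_function.intros(2,4)
      real_polynomial_function_monomial_fun)

lemma form_scaleR: "form k v (t *\<^sub>R x) = t ^ k * form k v x"
  unfolding form_def sum_distrib_left
  by (intro sum.cong refl) (simp add: monomial_fun_scaleR exponents_def)

lemma form_coeffs_unique:
  assumes "\<And>x. form d u x = form d v x" "\<alpha> \<in> exponents d"
  shows "u \<alpha> = v \<alpha>"
  using assms monomial_fun_coeffs_unique[OF finite_exponents] unfolding form_def by blast

text \<open>Along the ray through a fixed \<open>x\<close>, \<open>q\<close> is a polynomial in
  \<open>t\<close> whose coefficient at \<open>t ^ e\<close> is the degree \<open>e\<close> part of
  \<open>q\<close> at \<open>x\<close>. The bound makes it vanish unless \<open>e = k\<close>.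
  Arguing ray by ray lets the constant depend on \<open>x\<close>.\<close>

lemma bounded_growth_imp_form:
  fixes q :: "real ^ 'n::finite \<Rightarrow> real"
  assumes "real_polynomial_function q"
    and bd: "\<And>x t. t > 0 \<Longrightarrow> \<bar>q (t *\<^sub>R x)\<bar> \<le> C x * t ^ k"
  shows "\<exists>v. \<forall>x. q x = form k v x"
proof -
  obtain S c where S: "finite S" and q: "\<And>x. q x = (\<Sum>\<beta>\<in>S. c \<beta> * monomial_fun \<beta> x)"
    using real_polynomial_function_imp_expansion[OF assms(1)] unfolding monomial_expansion_def by blast
  define deg :: "('n \<Rightarrow> nat) \<Rightarrow> nat" where "deg \<beta> = (\<Sum>j\<in>UNIV. \<beta> j)" for \<beta>
  \<comment> \<open>\<open>S\<close> may miss some exponents of degree \<open>k\<close>; these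
    receive coefficient 0.\<close>
  have "q x = form k (\<lambda>\<beta>. if \<beta> \<in> S then c \<beta> else 0) x" for x
  proof -
    have "(\<Sum>\<beta>\<in>{\<beta>\<in>S. deg \<beta> = e}. c \<beta> * monomial_fun \<beta> x) = 0" if "e \<noteq> k" for e
      using bd[of _ x]
      by (intro power_sum_bounded_imp_zero[OF S _ that])
        (simp add: q monomial_fun_scaleR deg_def mult_ac)
    \<comment> \<open>Inserting \<open>k\<close> provides an index for the degree \<open>k\<close>
      part even if no exponent in \<open>S\<close> has that degree.\<close>
    then have "(\<Sum>e\<in>insert k (deg ` S). \<Sum>\<beta>\<in>{\<beta>\<in>S. deg \<beta> = e}. c \<beta> * monomial_fun \<beta> x) =
        (\<Sum>e\<in>insert k (deg ` S). if e = k then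
          (\<Sum>\<beta>\<in>{\<beta>\<in>S. deg \<beta> = k}. c \<beta> * monomial_fun \<beta> x) else 0)"
      by (intro sum.cong) auto
    then have "q x = (\<Sum>\<beta>\<in>{\<beta>\<in>S. deg \<beta> = k}. c \<beta> * monomial_fun \<beta> x)"
      using S by (subst (asm) sum.group) (auto simp: q)
    also have "\<dots> = (\<Sum>\<beta>\<in>exponents k. if \<beta> \<in> S then c \<beta> * monomial_fun \<beta> x else 0)"
      using S by (subst sum.inter_restrict[OF finite_exponents, symmetric])
        (auto intro!: sum.cong simp: deg_def exponents_def)
    finally show ?thesis
      unfolding form_def by (auto intro!: sum.cong)
  qed
  then show ?thesis
    by blast
qed

lemma add_in_exponents:
  "\<beta> \<in> exponents k \<Longrightarrow> \<gamma> \<in> exponents l \<Longrightarrow> (\<lambda>j. \<beta> j + \<gamma> j) \<in> exponents (k + l)"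
  by (simp add: exponents_def sum.distrib)

text \<open>These are the coefficients of the square of \<open>form k v\<close>, as
  \<open>form_square\<close> shows.\<close>

definition square_coeff :: "nat \<Rightarrow> (('n::finite \<Rightarrow> nat) \<Rightarrow> real) \<Rightarrow> ('n \<Rightarrow> nat) \<Rightarrow> real" where
  "square_coeff k v \<alpha> = (\<Sum>(\<beta>, \<gamma>)\<in>{(\<beta>, \<gamma>)\<in>exponents k \<times> exponents k. (\<lambda>j. \<beta> j + \<gamma> j) = \<alpha>}. v \<beta> * v \<gamma>)"

text \<open>The weight \<open>g\<close> stays free for two uses: monomials give the square of a
  form, while \<open>entry B\<close> gives the quadratic form of the matrix.\<close>

lemma sum_square_coeff:
  fixes v :: "('n::finite \<Rightarrow> nat) \<Rightarrow> real"
  shows "(\<Sum>\<alpha>\<in>exponents (2 * k). square_coeff k v \<alpha> * g \<alpha>) =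
    (\<Sum>\<beta>\<in>exponents k. \<Sum>\<gamma>\<in>exponents k. v \<beta> * v \<gamma> * g (\<lambda>j. \<beta> j + \<gamma> j))"
proof -
  let ?E = "exponents k :: ('n \<Rightarrow> nat) set"
  let ?add = "\<lambda>(\<beta> :: 'n \<Rightarrow> nat, \<gamma>) j. \<beta> j + \<gamma> j"
  have fin: "finite (?E \<times> ?E)"
    by (simp add: finite_exponents)
  have "(\<Sum>\<beta>\<in>?E. \<Sum>\<gamma>\<in>?E. v \<beta> * v \<gamma> * g (\<lambda>j. \<beta> j + \<gamma> j)) =
      (\<Sum>p\<in>?E \<times> ?E. v (fst p) * v (snd p) * g (?add p))"
    by (simp add: sum.cartesian_product case_prod_unfold)
  also have "\<dots> = (\<Sum>\<alpha>\<in>exponents (2 * k). \<Sum>p\<in>{p\<in>?E \<times> ?E. ?add p = \<alpha>}.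
      v (fst p) * v (snd p) * g (?add p))"
    using add_in_exponents[of _ k _ k]
    by (intro sum.group[OF fin finite_exponents, symmetric]) (auto simp: mult_2)
  also have "\<dots> = (\<Sum>\<alpha>\<in>exponents (2 * k). square_coeff k v \<alpha> * g \<alpha>)"
    unfolding square_coeff_def sum_distrib_right
    by (intro sum.cong refl) (auto simp: case_prod_unfold)
  finally show ?thesis
    by simp
qed

lemma form_square: "(form k v x)\<^sup>2 = form (2 * k) (square_coeff k v) x"
  unfolding form_def[of "2 * k"] sum_square_coeff
  by (simp add: form_def power2_eq_square sum_product monomial_fun_add mult_ac)

section \<open>Tensors\<close>

text \<open>For symmetric \<open>A\<close> and \<open>\<alpha>\<close> of degree
  \<open>CARD('m)\<close> this is \<open>entry A \<alpha>\<close> times a multinomial coefficient,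
  the number of index tuples with content \<open>\<alpha>\<close>.\<close>

definition form_coeff :: "('m::finite, 'n::finite) tensor \<Rightarrow> ('n \<Rightarrow> nat) \<Rightarrow> real" where
  "form_coeff A \<alpha> = (\<Sum>i\<in>{i. content i = \<alpha>}. A $ i)"

lemma tensor_form_eq_form:
  fixes A :: "('m::finite, 'n::finite) tensor"
  shows "tensor_form A x = form CARD('m) (form_coeff A) x"
proof -
  have "tensor_form A x = (\<Sum>i\<in>UNIV. A $ i * monomial_fun (content i) x)"
    by (simp add: tensor_form_def prod_nth_eq_monomial_fun)
  also have "\<dots> = (\<Sum>\<alpha>\<in>exponents CARD('m). \<Sum>i\<in>{i\<in>UNIV. content i = \<alpha>}.
      A $ i * monomial_fun (content i) x)"
    by (rule sum.group[symmetric]) (auto simp: finite_exponents content_in_exponents)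
  finally show ?thesis
    by (simp add: form_def form_coeff_def sum_distrib_right)
qed

text \<open>\<open>B\<close> is constant on tuples of equal content, so only the sums of
  \<open>A\<close> over these classes enter. The multinomial weights are already contained in
  \<open>form_coeff A\<close>.\<close>

lemma inner_eq_sum_entry:
  fixes A B :: "('m::finite, 'n::finite) tensor"
  assumes "B \<in> sym_tensors"
  shows "B \<bullet> A = (\<Sum>\<alpha>\<in>exponents CARD('m). form_coeff A \<alpha> * entry B \<alpha>)"
proof -
  have "B \<bullet> A = (\<Sum>i\<in>UNIV. A $ i * entry B (content i))"
    by (simp add: inner_tensor entry_content[OF assms] mult.commute)
  also have "\<dots> = (\<Sum>\<alpha>\<in>exponents CARD('m). \<Sum>i\<in>{i\<in>UNIV. content i = \<alpha>}.
      A $ i * entry B (content i))"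
    by (rule sum.group[symmetric]) (auto simp: finite_exponents content_in_exponents)
  finally show ?thesis
    by (simp add: form_coeff_def sum_distrib_right)
qed

section \<open>Symmetric tensors with prescribed form coefficients\<close>

lemma ex_content:
  fixes \<alpha> :: "'n::finite \<Rightarrow> nat"
  assumes "\<alpha> \<in> exponents CARD('m::finite)"
  shows "\<exists>i :: 'm \<Rightarrow> 'n. content i = \<alpha>"
proof -
  \<comment> \<open>As \<open>'n\<close> is finite, \<open>\<alpha>\<close> is the multiplicity
    function of a multiset. Listing its elements and numbering the positions by \<open>'m\<close>
    yields the index tuple.\<close>
  obtain xs where xs: "mset xs = Abs_multiset \<alpha>"
    using ex_mset by blast
  have cnt: "count (mset xs) = \<alpha>"
    unfolding xs by (simp add: count_Abs_multiset)
  have "length xs = (\<Sum>j\<in>set xs. count (mset xs) j)"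
    using size_multiset_overloaded_eq[of "mset xs"] by simp
  also have "\<dots> = (\<Sum>j\<in>UNIV. count (mset xs) j)"
    by (intro sum.mono_neutral_left) (auto simp: count_eq_zero_iff)
  also have "\<dots> = CARD('m)"
    using assms by (simp add: cnt exponents_def)
  finally have len: "length xs = CARD('m)" .
  obtain h :: "'m \<Rightarrow> nat" where h: "bij_betw h UNIV {..<length xs}"
    using ex_bij_betw_finite_nat[of "UNIV :: 'm set"] unfolding len atLeast0LessThan by auto
  have "content (\<lambda>l. xs ! h l) j = \<alpha> j" for j
  proof -
    have "bij_betw h {l. xs ! h l = j} {a. a < length xs \<and> xs ! a = j}"
      using h unfolding bij_betw_def
      by (auto simp: inj_on_def image_iff set_eq_iff) metis
    then have "content (\<lambda>l. xs ! h l) j = card {a. a < length xs \<and> xs ! a = j}"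
      by (simp add: content_def bij_betw_same_card)
    also have "\<dots> = count (mset xs) j"
      by (simp add: count_mset count_list_eq_length_filter length_filter_conv_card
          eq_commute)
    finally show ?thesis
      by (simp add: cnt)
  qed
  then show ?thesis
    by blast
qed

lemma content_comp_permutes:
  assumes "p permutes UNIV"
  shows "content (i \<circ> p) = content i"
proof
  fix j
  have "bij_betw p {l. i (p l) = j} {l. i l = j}"
    using permutes_bij[OF assms] unfolding bij_betw_def
    by (auto simp: inj_on_def image_iff)
  then show "content (i \<circ> p) j = content i j"
    by (simp add: content_def bij_betw_same_card)
qed

lemma ex_sym_tensor_form_coeff:
  fixes w :: "('n::finite \<Rightarrow> nat) \<Rightarrow> real"
  shows "\<exists>A \<in> (sym_tensors :: ('m::finite, 'n) tensor set).
    \<forall>\<alpha>\<in>exponents CARD('m). form_coeff A \<alpha> = w \<alpha>"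
proof
  define N where "N \<alpha> = card {i :: 'm \<Rightarrow> 'n. content i = \<alpha>}" for \<alpha>
  \<comment> \<open>The prescribed value is spread evenly over all tuples of the same content, which
    makes the tensor symmetric.\<close>
  let ?A = "(\<chi> i. w (content i) / real (N (content i))) :: ('m, 'n) tensor"
  show "?A \<in> sym_tensors"
    by (simp add: sym_tensors_def content_comp_permutes)
  show "\<forall>\<alpha>\<in>exponents CARD('m). form_coeff ?A \<alpha> = w \<alpha>"
  proof
    fix \<alpha> :: "'n \<Rightarrow> nat"
    assume "\<alpha> \<in> exponents CARD('m)"
    then have "N \<alpha> \<noteq> 0"
      using ex_content[where 'm = 'm, of \<alpha>] by (auto simp: N_def)
    have "form_coeff ?A \<alpha> = (\<Sum>i\<in>{i :: 'm \<Rightarrow> 'n. content i = \<alpha>}. w \<alpha> / real (N \<alpha>))"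
      unfolding form_coeff_def by (intro sum.cong) auto
    with \<open>N \<alpha> \<noteq> 0\<close> show "form_coeff ?A \<alpha> = w \<alpha>"
      by (simp add: N_def)
  qed
qed

section \<open>The moment matrix and sums of squares\<close>

lemma sum_entry_exponent_matrix:
  assumes "\<beta> \<in> exponents k" "\<gamma> \<in> exponents k"
  shows "(\<Sum>\<alpha>\<in>exponents (2 * k). entry B \<alpha> * exponent_matrix \<alpha> \<beta> \<gamma>) = entry B (\<lambda>j. \<beta> j + \<gamma> j)"
proof -
  have "(\<Sum>\<alpha>\<in>exponents (2 * k). entry B \<alpha> * exponent_matrix \<alpha> \<beta> \<gamma>) =
      (\<Sum>\<alpha>\<in>exponents (2 * k). if \<alpha> = (\<lambda>j. \<beta> j + \<gamma> j) then entry B \<alpha> else 0)"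
    by (intro sum.cong) (auto simp: exponent_matrix_def)
  then show ?thesis
    using add_in_exponents[OF assms] by (simp add: finite_exponents mult_2)
qed

text \<open>The matrix has \<open>entry B\<close> of the sum of the two exponents in each position,
  so \<open>sum_square_coeff\<close> with \<open>g = entry B\<close> evaluates its quadratic form.
  Symmetry comes from commutativity of addition.\<close>

lemma psd_on_exponent_matrix_iff:
  "psd_on (exponents k) (\<lambda>\<beta> \<gamma>. \<Sum>\<alpha>\<in>exponents (2 * k). entry B \<alpha> * exponent_matrix \<alpha> \<beta> \<gamma>) \<longleftrightarrow>
    (\<forall>v. (\<Sum>\<alpha>\<in>exponents (2 * k). square_coeff k v \<alpha> * entry B \<alpha>) \<ge> 0)"
proof -
  let ?M = "\<lambda>\<beta> \<gamma>. \<Sum>\<alpha>\<in>exponents (2 * k). entry B \<alpha> * exponent_matrix \<alpha> \<beta> \<gamma>"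
  have "?M \<beta> \<gamma> = ?M \<gamma> \<beta>" for \<beta> \<gamma>
    by (simp add: exponent_matrix_def add.commute)
  moreover have "(\<Sum>\<beta>\<in>exponents k. \<Sum>\<gamma>\<in>exponents k. v \<beta> * ?M \<beta> \<gamma> * v \<gamma>) =
      (\<Sum>\<alpha>\<in>exponents (2 * k). square_coeff k v \<alpha> * entry B \<alpha>)" for v
    unfolding sum_square_coeff
    by (intro sum.cong refl) (simp add: sum_entry_exponent_matrix)
  ultimately show ?thesis
    unfolding psd_on_def by simp
qed

text \<open>The summands are squares of forms of degree \<open>k\<close> by
  \<open>bounded_growth_imp_form\<close>; uniqueness of coefficients then turns the identity of
  functions into one of coefficients.\<close>

lemma SOS_form_coeff:
  fixes A :: "('m::finite, 'n::finite) tensor"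
  assumes "sum_of_squares (tensor_form A)" and card: "CARD('m) = 2 * k"
  obtains r :: nat and v where
    "\<And>\<alpha>. \<alpha> \<in> exponents (2 * k) \<Longrightarrow> form_coeff A \<alpha> = (\<Sum>s<r. square_coeff k (v s) \<alpha>)"
proof -
  obtain r :: nat and q where q: "\<And>s. s < r \<Longrightarrow> real_polynomial_function (q s)"
    and sq: "\<And>x. tensor_form A x = (\<Sum>s<r. (q s x)\<^sup>2)"
    using assms(1) unfolding sum_of_squares_def by metis
  have A: "tensor_form A x = form (2 * k) (form_coeff A) x" for x
    by (simp add: tensor_form_eq_form card)
  have "\<exists>v. \<forall>x. q s x = form k v x" if "s < r" for s
  proof (rule bounded_growth_imp_form[OF q[OF that]])
    fix x :: "real ^ 'n" and t :: real
    assume "t > 0"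
    \<comment> \<open>No cancellation can occur among squares, so each one is bounded by the whole
      sum, which is homogeneous of degree \<open>2 * k\<close>.\<close>
    have "(q s (t *\<^sub>R x))\<^sup>2 \<le> tensor_form A (t *\<^sub>R x)"
      unfolding sq using that by (intro member_le_sum[where f = "\<lambda>s. (q s (t *\<^sub>R x))\<^sup>2"]) auto
    also have "\<dots> = tensor_form A x * (t ^ k)\<^sup>2"
      by (simp add: A form_scaleR power_mult[symmetric] mult.commute)
    finally show "\<bar>q s (t *\<^sub>R x)\<bar> \<le> sqrt (tensor_form A x) * t ^ k"
      using \<open>t > 0\<close> real_sqrt_le_mono by (fastforce simp: real_sqrt_mult)
  qed
  then obtain v where v: "\<And>s x. s < r \<Longrightarrow> q s x = form k (v s) x"
    by metis
  have "form (2 * k) (form_coeff A) x = form (2 * k) (\<lambda>\<alpha>. \<Sum>s<r. square_coeff k (v s) \<alpha>) x" for x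
  proof -
    have "form (2 * k) (form_coeff A) x = (\<Sum>s<r. form (2 * k) (square_coeff k (v s)) x)"
      by (simp add: A[symmetric] sq v form_square)
    also have "\<dots> = form (2 * k) (\<lambda>\<alpha>. \<Sum>s<r. square_coeff k (v s) \<alpha>) x"
      unfolding form_def sum_distrib_right by (rule sum.swap)
    finally show ?thesis .
  qed
  then show thesis
    using form_coeffs_unique that by blast
qed

text \<open>This supplies the test tensors for the dual cone: every coefficient vector
  \<open>v\<close> is reached through a single square.\<close>

lemma ex_SOS_tensor_square:
  assumes card: "CARD('m::finite) = 2 * k"
  shows "\<exists>A \<in> (SOS_tensors :: ('m, 'n::finite) tensor set).
    \<forall>\<alpha>\<in>exponents (2 * k). form_coeff A \<alpha> = square_coeff k v \<alpha>"
proof -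
  obtain A :: "('m, 'n) tensor" where A: "A \<in> sym_tensors"
    "\<forall>\<alpha>\<in>exponents (2 * k). form_coeff A \<alpha> = square_coeff k v \<alpha>"
    using ex_sym_tensor_form_coeff[where 'm = 'm, of "square_coeff k v"] card by auto
  have "tensor_form A x = (form k v x)\<^sup>2" for x
    using A by (simp add: tensor_form_eq_form card form_square form_def[of "2 * k"])
  then have "sum_of_squares (tensor_form A)"
    unfolding sum_of_squares_def
    by (intro exI[of _ "1 :: nat"] exI[of _ "\<lambda>_. form k v"])
      (simp add: real_polynomial_function_form)
  with A show ?thesis
    by (auto simp: SOS_tensors_def)
qed

theorem theorem4:
  fixes k :: nat
  assumes "k > 0" and "CARD('m::finite) = 2 * k"
  shows "(SOS_dual :: ('m, 'n::finite) tensor set) =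
    {B \<in> sym_tensors. psd_on (exponents k)
       (\<lambda>\<beta> \<gamma>. \<Sum>\<alpha>\<in>exponents CARD('m). entry B \<alpha> * exponent_matrix \<alpha> \<beta> \<gamma>)}"
proof -
  have "(\<forall>A\<in>SOS_tensors. B \<bullet> A \<ge> 0) \<longleftrightarrow>
      (\<forall>v. (\<Sum>\<alpha>\<in>exponents (2 * k). square_coeff k v \<alpha> * entry B \<alpha>) \<ge> 0)"
    if B: "B \<in> sym_tensors" for B :: "('m, 'n) tensor"
  proof (intro iffI ballI allI)
    fix v
    assume "\<forall>A\<in>SOS_tensors. B \<bullet> A \<ge> 0"
    \<comment> \<open>Pairing \<open>B\<close> with the tensor of the square of
      \<open>form k v\<close> produces exactly the quadratic form at \<open>v\<close>.\<close>
    then show "(\<Sum>\<alpha>\<in>exponents (2 * k). square_coeff k v \<alpha> * entry B \<alpha>) \<ge> 0"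
      using ex_SOS_tensor_square[OF assms(2), where 'n = 'n, of v]
      by (auto simp: inner_eq_sum_entry[OF B] assms(2))
  next
    fix A :: "('m, 'n) tensor"
    assume pos: "\<forall>v. (\<Sum>\<alpha>\<in>exponents (2 * k). square_coeff k v \<alpha> * entry B \<alpha>) \<ge> 0"
      and "A \<in> SOS_tensors"
    then obtain r :: nat and v where
      "\<And>\<alpha>. \<alpha> \<in> exponents (2 * k) \<Longrightarrow> form_coeff A \<alpha> = (\<Sum>s<r. square_coeff k (v s) \<alpha>)"
      using SOS_form_coeff[OF _ assms(2)] unfolding SOS_tensors_def by blast
    \<comment> \<open>The pairing is linear in \<open>form_coeff A\<close>, so it splits into values
      of the quadratic form at the vectors \<open>v s\<close>, each nonnegative.\<close>
    then have "B \<bullet> A = (\<Sum>\<alpha>\<in>exponents (2 * k). \<Sum>s<r. square_coeff k (v s) \<alpha> * entry B \<alpha>)"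
      by (simp add: inner_eq_sum_entry[OF B] assms(2) sum_distrib_right)
    also have "\<dots> = (\<Sum>s<r. \<Sum>\<alpha>\<in>exponents (2 * k). square_coeff k (v s) \<alpha> * entry B \<alpha>)"
      by (rule sum.swap)
    also have "\<dots> \<ge> 0"
      using pos by (simp add: sum_nonneg)
    finally show "B \<bullet> A \<ge> 0" .
  qed
  then show ?thesis
    unfolding SOS_dual_def assms(2) psd_on_exponent_matrix_iff by blast
qed

end
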